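(* Let $G$ be a nonempty graph on $n$ vertices with maximum degree $\Delta$ and minimum degree $\delta$, and let $n'$ be the largest number of vertices of $G$ with pairwise distinct closed neighborhoods. Let $d(v)$ denote the degree of $v$. Then $$\frac{n'+\delta}{\Delta+1}\le s^*(G)\le \max\{(n-d(v)-1)(d(v)+1)+2 : v\in V(G)\}\le (\Delta+1)n.$$
   Context: For a graph $G$ and vertex $v$, $N[v]=\{v\}\cup\{u: uv\in E(G)\}$ is the closed neighborhood of $v$. For a labeling $f:V(G)\to\{1,2,\dots\}$ let $s^*_f(v)=\sum_{x\in N[v]}f(x)$. The labeling is vertex sum-distinguishing if $s^*_f(u)\ne s^*_f(v)$ for all $u,v\in V(G)$ with $N[u]\ne N[v]$. Let $s^*(G)$ be the smallest integer $k$ such that $G$ has a vertex sum-distinguishing labeling with all labels in $\{1,\dots,k\}$. *)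

theory Defs
  imports Complex_Main "Graph_Theory.Graph_Theory"
begin

text \<open>
  A finite simple graph is a \<open>pair_graph\<close>: a finite, loop-free, symmetric digraph whose arcs are
  ordered pairs of vertices, so an edge \<open>uv\<close> is present as both \<open>(u, v)\<close> and \<open>(v, u)\<close>.
  By symmetry, the out-degree of a vertex is its degree.
\<close>

abbreviation deg :: "'a pair_pre_digraph \<Rightarrow> 'a \<Rightarrow> nat" where
  "deg G v \<equiv> out_degree (with_proj G) v"

definition max_degree :: "'a pair_pre_digraph \<Rightarrow> nat" where
  "max_degree G = Max (deg G ` pverts G)"

definition min_degree :: "'a pair_pre_digraph \<Rightarrow> nat" where
  "min_degree G = Min (deg G ` pverts G)"

definition closed_nbhd :: "'a pair_pre_digraph \<Rightarrow> 'a \<Rightarrow> 'a set" where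
  "closed_nbhd G v = insert v {u. (u, v) \<in> parcs G}"

definition num_distinct_nbhds :: "'a pair_pre_digraph \<Rightarrow> nat" where
  "num_distinct_nbhds G = Max (card ` {S. S \<subseteq> pverts G \<and> inj_on (closed_nbhd G) S})"

definition nbhd_sum :: "'a pair_pre_digraph \<Rightarrow> ('a \<Rightarrow> nat) \<Rightarrow> 'a \<Rightarrow> nat" where
  "nbhd_sum G f v = (\<Sum>x\<in>closed_nbhd G v. f x)"

definition vertex_sum_distinguishing :: "'a pair_pre_digraph \<Rightarrow> ('a \<Rightarrow> nat) \<Rightarrow> bool" where
  "vertex_sum_distinguishing G f \<longleftrightarrow>
     (\<forall>v\<in>pverts G. 1 \<le> f v) \<and>
     (\<forall>u\<in>pverts G. \<forall>v\<in>pverts G.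
        closed_nbhd G u \<noteq> closed_nbhd G v \<longrightarrow> nbhd_sum G f u \<noteq> nbhd_sum G f v)"

text \<open>
  Labels with distinct powers of two separate all distinct closed neighborhoods, so for a finite
  graph the minimum below is attained.
\<close>

definition s_star :: "'a pair_pre_digraph \<Rightarrow> nat" where
  "s_star G = (LEAST k. \<exists>f. vertex_sum_distinguishing G f \<and> f ` pverts G \<subseteq> {1..k})"

end

theory Submission
  imports Defs
begin

text \<open>
  For the upper bound, choose the labels greedily, one vertex at a time. When \<open>v\<close> is labelled, the
  partial sums of two closed neighborhoods change relative to each other only if \<open>v\<close> lies in
  exactly one of them; there are \<open>(d(v) + 1) (n - d(v) - 1)\<close> such pairs, and each of them excludes
  at most one label. For the lower bound, the \<open>n'\<close> distinct sums all lie between \<open>\<delta> + 1\<close> and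
  \<open>(\<Delta> + 1) s\<^sup>*(G)\<close>.
\<close>

text \<open>Stated for an arbitrary finite family of sets cut down to \<open>A\<close>, so that the
  induction can enlarge \<open>A\<close> while the index set \<open>I\<close> and the count of pairs
  separated by \<open>v\<close> stay fixed. Each step keeps the old labels and only picks the label
  of the new element.\<close>

lemma greedy_distinct_sums:
  fixes N :: "'i \<Rightarrow> 'a set"
  assumes I: "finite I" and A: "finite A"
    and bound: "\<And>v. v \<in> A \<Longrightarrow> card {i \<in> I. v \<in> N i} * card {i \<in> I. v \<notin> N i} < K"
  shows "\<exists>f. f ` A \<subseteq> {1..K} \<and>
    (\<forall>i\<in>I. \<forall>j\<in>I. N i \<inter> A \<noteq> N j \<inter> A \<longrightarrow> sum f (N i \<inter> A) \<noteq> sum f (N j \<inter> A))"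
  using A bound
proof (induction A rule: finite_induct)
  case empty
  show ?case by simp
next
  case (insert v A)
  have "\<exists>f. f ` A \<subseteq> {1..K} \<and>
      (\<forall>i\<in>I. \<forall>j\<in>I. N i \<inter> A \<noteq> N j \<inter> A \<longrightarrow> sum f (N i \<inter> A) \<noteq> sum f (N j \<inter> A))"
    by (rule insert.IH) (rule insert.prems, rule insertI2)
  then obtain f where f: "f ` A \<subseteq> {1..K}"
    and sep: "\<forall>i\<in>I. \<forall>j\<in>I. N i \<inter> A \<noteq> N j \<inter> A \<longrightarrow> sum f (N i \<inter> A) \<noteq> sum f (N j \<inter> A)"
    by (elim exE conjE)
  let ?In = "{i \<in> I. v \<in> N i}" and ?Out = "{i \<in> I. v \<notin> N i}"
  \<comment> \<open>Truncated subtraction is harmless here: it yields \<open>0\<close>, which is not an admissible label.\<close>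
  define forbidden where
    "forbidden = (\<lambda>(i, j). sum f (N j \<inter> A) - sum f (N i \<inter> A)) ` (?In \<times> ?Out)"
  have "card forbidden \<le> card (?In \<times> ?Out)"
    unfolding forbidden_def using I by (intro card_image_le) simp
  also have "\<dots> < card {1..K}"
    using insert.prems[of v] by (simp add: card_cartesian_product)
  finally have "\<not> {1..K} \<subseteq> forbidden"
    using I card_mono[of forbidden "{1..K}"] by (auto simp: forbidden_def)
  then obtain c where c: "c \<in> {1..K}" "c \<notin> forbidden"
    by blast
  let ?f = "f(v := c)"
  have unchanged: "sum ?f (N i \<inter> A) = sum f (N i \<inter> A)" for i
    using insert.hyps(2) by (intro sum.cong) auto
  have new_sum: "sum ?f (N i \<inter> insert v A) = (if v \<in> N i then c else 0) + sum f (N i \<inter> A)" for i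
    using insert.hyps unchanged[of i] by simp
  \<comment> \<open>Avoiding \<open>forbidden\<close> also handles pairs whose traces on
    \<open>A\<close> coincide and that differ only through \<open>v\<close>.\<close>
  have cross: "c + sum f (N i \<inter> A) \<noteq> sum f (N j \<inter> A)" if "i \<in> ?In" "j \<in> ?Out" for i j
  proof
    assume "c + sum f (N i \<inter> A) = sum f (N j \<inter> A)"
    then have "c = sum f (N j \<inter> A) - sum f (N i \<inter> A)" by simp
    then have "c \<in> forbidden"
      unfolding forbidden_def using that by (intro image_eqI[of _ _ "(i, j)"]) simp_all
    with c(2) show False by contradiction
  qed
  have "sum ?f (N i \<inter> insert v A) \<noteq> sum ?f (N j \<inter> insert v A)"
    if ij: "i \<in> I" "j \<in> I" and ne: "N i \<inter> insert v A \<noteq> N j \<inter> insert v A" for i j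
  proof (cases "v \<in> N i \<longleftrightarrow> v \<in> N j")
    case True
    \<comment> \<open>The new label enters both sums or neither, so the sets already differ on
      \<open>A\<close> and the old inequality survives.\<close>
    then have "N i \<inter> A \<noteq> N j \<inter> A" using ne by auto
    then have "sum f (N i \<inter> A) \<noteq> sum f (N j \<inter> A)" using sep ij by simp
    with True show ?thesis unfolding new_sum by simp
  next
    case False
    then show ?thesis
      unfolding new_sum using cross[of i j] cross[of j i] ij by auto
  qed
  moreover have "?f ` insert v A \<subseteq> {1..K}"
    using f c(1) by auto
  ultimately show ?case by (intro exI[of _ ?f]) simp
qed

context pair_graph
begin

lemma closed_nbhd_subset: "v \<in> pverts G \<Longrightarrow> closed_nbhd G v \<subseteq> pverts G"
  unfolding closed_nbhd_def using in_arcsD1 by fastforce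

lemma closed_nbhd_commute: "u \<in> closed_nbhd G v \<longleftrightarrow> v \<in> closed_nbhd G u"
  unfolding closed_nbhd_def using arcs_symmetric by auto

lemma card_closed_nbhd:
  assumes "v \<in> pverts G"
  shows "card (closed_nbhd G v) = deg G v + 1"
proof -
  \<comment> \<open>The degree counts arcs leaving \<open>v\<close>, whereas
    \<open>closed_nbhd\<close> collects the tails of arcs entering \<open>v\<close>; symmetry
    identifies the two, and the absence of loops justifies removing \<open>v\<close>.\<close>
  have "out_arcs (with_proj G) v = Pair v ` (closed_nbhd G v - {v})"
    unfolding out_arcs_def closed_nbhd_def using arcs_symmetric no_loops by fastforce
  then have "deg G v = card (closed_nbhd G v - {v})"
    unfolding out_degree_def by (simp add: card_image inj_on_def)
  moreover have "v \<in> closed_nbhd G v"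
    by (simp add: closed_nbhd_def)
  moreover have "finite (closed_nbhd G v)"
    by (rule finite_subset[OF closed_nbhd_subset[OF assms] pair_finite_verts])
  ultimately show ?thesis
    by (metis Suc_eq_plus1 card.remove)
qed

text \<open>The greedy lemma is applied with the vertices both as indices and as elements to be
  labelled.\<close>

lemma ex_vertex_sum_distinguishing:
  assumes bound: "\<And>v. v \<in> pverts G \<Longrightarrow> (deg G v + 1) * (card (pverts G) - (deg G v + 1)) < K"
  shows "\<exists>f. vertex_sum_distinguishing G f \<and> f ` pverts G \<subseteq> {1..K}"
proof -
  have "card {u \<in> pverts G. v \<in> closed_nbhd G u} * card {u \<in> pverts G. v \<notin> closed_nbhd G u} < K"
    if v: "v \<in> pverts G" for v
  proof -
    \<comment> \<open>By symmetry, the closed neighborhoods containing \<open>v\<close> are those of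
      the members of \<open>closed_nbhd G v\<close>, so the two counts are
      \<open>deg G v + 1\<close> and its complement in \<open>n\<close>.\<close>
    have "{u \<in> pverts G. v \<in> closed_nbhd G u} = closed_nbhd G v"
      and "{u \<in> pverts G. v \<notin> closed_nbhd G u} = pverts G - closed_nbhd G v"
      using closed_nbhd_subset[OF v] closed_nbhd_commute by blast+
    then show ?thesis
      using bound[OF v] card_closed_nbhd[OF v] closed_nbhd_subset[OF v]
      by (simp add: card_Diff_subset finite_subset[OF _ pair_finite_verts])
  qed
  from greedy_distinct_sums[OF pair_finite_verts pair_finite_verts this]
  obtain f where "f ` pverts G \<subseteq> {1..K}"
    and "\<forall>u\<in>pverts G. \<forall>v\<in>pverts G.
      closed_nbhd G u \<inter> pverts G \<noteq> closed_nbhd G v \<inter> pverts G \<longrightarrow>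
      sum f (closed_nbhd G u \<inter> pverts G) \<noteq> sum f (closed_nbhd G v \<inter> pverts G)"
    by auto
  then show ?thesis
    unfolding vertex_sum_distinguishing_def nbhd_sum_def
    by (intro exI[of _ f]) (auto simp: closed_nbhd_subset Int_absorb2)
qed

lemma s_star_attained:
  "\<exists>f. vertex_sum_distinguishing G f \<and> f ` pverts G \<subseteq> {1..s_star G}"
proof -
  \<comment> \<open>Any number above every product serves as a witness for \<open>LEAST\<close>; one
    more than their sum is such a number, even for an empty sum.\<close>
  let ?K = "Suc (\<Sum>u\<in>pverts G. (deg G u + 1) * (card (pverts G) - (deg G u + 1)))"
  have "(deg G v + 1) * (card (pverts G) - (deg G v + 1)) < ?K" if "v \<in> pverts G" for v
    unfolding less_Suc_eq_le
    using that member_le_sum[of v "pverts G" "\<lambda>u. (deg G u + 1) * (card (pverts G) - (deg G u + 1))"]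
    by simp
  then have "\<exists>f. vertex_sum_distinguishing G f \<and> f ` pverts G \<subseteq> {1..?K}"
    by (rule ex_vertex_sum_distinguishing)
  then show ?thesis
    unfolding s_star_def by (rule LeastI)
qed

lemma s_star_le:
  assumes "\<And>v. v \<in> pverts G \<Longrightarrow> (deg G v + 1) * (card (pverts G) - (deg G v + 1)) < K"
  shows "s_star G \<le> K"
  unfolding s_star_def by (rule Least_le, rule ex_vertex_sum_distinguishing, rule assms)

lemma num_distinct_nbhds_attained:
  obtains S where "S \<subseteq> pverts G" "inj_on (closed_nbhd G) S" "card S = num_distinct_nbhds G"
proof -
  let ?T = "{S. S \<subseteq> pverts G \<and> inj_on (closed_nbhd G) S}"
  have "{} \<in> ?T" by simp
  then have "num_distinct_nbhds G \<in> card ` ?T"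
    unfolding num_distinct_nbhds_def by (intro Max_in) auto
  then show thesis using that by auto
qed

text \<open>Pigeonhole: the sums over a largest set of vertices with distinct closed neighborhoods
  are distinct integers in an interval with at most
  \<open>(max_degree G + 1) * k - min_degree G\<close> elements.\<close>

lemma num_distinct_nbhds_le:
  assumes f: "vertex_sum_distinguishing G f" "f ` pverts G \<subseteq> {1..k}" and ne: "pverts G \<noteq> {}"
  shows "num_distinct_nbhds G + min_degree G \<le> (max_degree G + 1) * k"
proof -
  obtain S where S: "S \<subseteq> pverts G" "inj_on (closed_nbhd G) S" "card S = num_distinct_nbhds G"
    by (rule num_distinct_nbhds_attained)
  have range: "nbhd_sum G f v \<in> {min_degree G + 1..(max_degree G + 1) * k}"
    if v: "v \<in> pverts G" for v
  proof -
    have lab: "1 \<le> f x \<and> f x \<le> k" if "x \<in> closed_nbhd G v" for x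
      using that f(2) closed_nbhd_subset[OF v] by fastforce
    have "min_degree G \<le> deg G v" "deg G v \<le> max_degree G"
      unfolding min_degree_def max_degree_def using v by auto
    moreover have "card (closed_nbhd G v) \<le> nbhd_sum G f v"
      unfolding nbhd_sum_def using sum_bounded_below[of "closed_nbhd G v" 1 f] lab by simp
    moreover have "nbhd_sum G f v \<le> card (closed_nbhd G v) * k"
      unfolding nbhd_sum_def using sum_bounded_above[of "closed_nbhd G v" f k] lab by simp
    moreover have "(deg G v + 1) * k \<le> (max_degree G + 1) * k"
      using calculation(2) by (intro mult_right_mono) auto
    ultimately show ?thesis
      unfolding card_closed_nbhd[OF v] atLeastAtMost_iff by linarith
  qed
  have "inj_on (nbhd_sum G f) S"
    using f(1) S unfolding vertex_sum_distinguishing_def inj_on_def by blast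
  then have "card S = card (nbhd_sum G f ` S)"
    by (simp add: card_image)
  also have "\<dots> \<le> card {min_degree G + 1..(max_degree G + 1) * k}"
    using range S(1) by (intro card_mono) auto
  finally have le: "num_distinct_nbhds G \<le> (max_degree G + 1) * k - min_degree G"
    using S(3) by simp
  \<comment> \<open>The subtraction in \<open>le\<close> is truncated. Some sum lies in the
    interval, so nothing is cut off and \<open>min_degree G\<close> can be moved across.\<close>
  obtain v where "v \<in> pverts G" using ne by blast
  from range[OF this] have "min_degree G \<le> (max_degree G + 1) * k" by simp
  with le show ?thesis by linarith
qed

end

text \<open>A nonempty graph is one with an edge. For an edgeless graph on \<open>n \<ge> 1\<close>
  vertices the maximum is \<open>n + 1\<close>, which exceeds the last bound
  \<open>n\<close>.\<close>

theorem theorem3: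
  fixes G :: "'a pair_pre_digraph" and n :: nat
  assumes "pair_graph G"
    and "parcs G \<noteq> {}"
    and "n = card (pverts G)"
  shows "(real (num_distinct_nbhds G) + real (min_degree G)) / (real (max_degree G) + 1)
           \<le> real (s_star G)
       \<and> real (s_star G)
           \<le> Max {(real n - real (deg G v) - 1) * (real (deg G v) + 1) + 2 | v. v \<in> pverts G}
       \<and> Max {(real n - real (deg G v) - 1) * (real (deg G v) + 1) + 2 | v. v \<in> pverts G}
           \<le> (real (max_degree G) + 1) * real n"
proof (intro conjI)
  interpret pair_graph G by fact
  let ?b = "\<lambda>v. (real n - real (deg G v) - 1) * (real (deg G v) + 1) + 2"
  have image: "{?b v | v. v \<in> pverts G} = ?b ` pverts G" by blast
  \<comment> \<open>An edge supplies \<open>1 \<le> max_degree G\<close> and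
    \<open>2 \<le> n\<close>, which the last inequality uses.\<close>
  obtain x y where xy: "(x, y) \<in> parcs G" using assms(2) by auto
  have x: "x \<in> pverts G" and y: "y \<in> closed_nbhd G x" and "x \<noteq> y"
    using in_arcsD1[OF xy] no_loops[OF xy] arcs_symmetric[OF xy] by (auto simp: closed_nbhd_def)
  then have ne: "pverts G \<noteq> {}" by auto
  have deg_less: "deg G v + 1 \<le> n" if "v \<in> pverts G" for v
    using card_closed_nbhd[OF that] closed_nbhd_subset[OF that] assms(3)
      card_mono[of "pverts G" "closed_nbhd G v"] by simp
  have deg_le: "deg G v \<le> max_degree G" if "v \<in> pverts G" for v
    unfolding max_degree_def using that by auto
  have "card {x, y} \<le> card (closed_nbhd G x)"
    using y by (intro card_mono finite_subset[OF closed_nbhd_subset[OF x] pair_finite_verts])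
      (auto simp: closed_nbhd_def)
  then have deg_x: "1 \<le> deg G x"
    using card_closed_nbhd[OF x] \<open>x \<noteq> y\<close> by simp
  then have Delta: "1 \<le> max_degree G" and n: "2 \<le> n"
    using deg_le[OF x] deg_less[OF x] by auto

  have "num_distinct_nbhds G + min_degree G \<le> (max_degree G + 1) * s_star G"
    using s_star_attained num_distinct_nbhds_le ne by blast
  from this[folded of_nat_le_iff[where 'a = real]]
  show "(real (num_distinct_nbhds G) + real (min_degree G)) / (real (max_degree G) + 1)
      \<le> real (s_star G)"
    by (simp add: divide_le_eq algebra_simps)

  \<comment> \<open>Since \<open>deg G v + 1 \<le> n\<close>, the truncated subtraction agrees with
    the real one.\<close>
  have b_nat: "real ((deg G v + 1) * (n - (deg G v + 1)) + 2) = ?b v" if v: "v \<in> pverts G" for v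
  proof -
    obtain m where "n = deg G v + 1 + m" using le_Suc_ex[OF deg_less[OF v]] by blast
    then show ?thesis by (simp add: algebra_simps)
  qed
  \<comment> \<open>The stated maximum, taken over natural numbers so that \<open>s_star_le\<close>
    applies; it is compared with the real maximum at a vertex \<open>w\<close> attaining it.\<close>
  define K where "K = Max ((\<lambda>v. (deg G v + 1) * (n - (deg G v + 1)) + 2) ` pverts G)"
  have "(deg G v + 1) * (card (pverts G) - (deg G v + 1)) < K" if "v \<in> pverts G" for v
  proof -
    have "(deg G v + 1) * (n - (deg G v + 1)) + 2 \<le> K"
      unfolding K_def using that by (intro Max_ge) auto
    then show ?thesis using assms(3) by simp
  qed
  then have K: "s_star G \<le> K" by (rule s_star_le)
  have "K \<in> (\<lambda>v. (deg G v + 1) * (n - (deg G v + 1)) + 2) ` pverts G"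
    unfolding K_def using ne by (intro Max_in) auto
  then obtain w where w: "w \<in> pverts G" "K = (deg G w + 1) * (n - (deg G w + 1)) + 2"
    by (elim imageE) (rule that)
  have "real (s_star G) \<le> real K"
    using K by (simp only: of_nat_le_iff)
  also have "real K = ?b w"
    unfolding w(2) by (rule b_nat[OF w(1)])
  also have "\<dots> \<le> Max (?b ` pverts G)"
    using w(1) by (intro Max_ge finite_imageI pair_finite_verts imageI)
  finally show "real (s_star G) \<le> Max {?b v | v. v \<in> pverts G}"
    unfolding image .

  have "?b v \<le> (real (max_degree G) + 1) * real n" if v: "v \<in> pverts G" for v
  proof (cases "deg G v = 0")
    case True
    \<comment> \<open>At an isolated vertex the value is \<open>n + 1\<close>; the edge elsewhere in
      the graph makes room for it.\<close>
    have "real n + 1 \<le> 2 * real n" using n by simp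
    also have "\<dots> \<le> (real (max_degree G) + 1) * real n"
      using Delta by (intro mult_right_mono) auto
    finally show ?thesis using True by simp
  next
    case False
    \<comment> \<open>With \<open>d = deg G v\<close>, the value is
      \<open>(d + 1) * n - (d + 1)^2 + 2\<close>, and the square is at least 4, which absorbs the
      2.\<close>
    then have "2 * 2 \<le> (real (deg G v) + 1) * (real (deg G v) + 1)"
      by (intro mult_mono) auto
    then have "?b v \<le> (real (deg G v) + 1) * real n"
      by (simp add: algebra_simps)
    also have "\<dots> \<le> (real (max_degree G) + 1) * real n"
      using deg_le[OF v] by (intro mult_right_mono) auto
    finally show ?thesis .
  qed
  then show "Max {?b v | v. v \<in> pverts G} \<le> (real (max_degree G) + 1) * real n"
    unfolding image using ne by (subst Max_le_iff) auto
qed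

end
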